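(* Consider the two-dimensional multi-dimensional Lagrange-Projection scheme (S) for the rescaled Euler equations described in the context. It is low Mach number compliant in the following sense. Let all discrete quantities be formal power series in $\epsilon$. Any data with $$p^{(0)}=\mathrm{const},\qquad p^{(1)}=\mathrm{const},$$ and (discrete counterpart to $\mathrm{div}\,\mathbf v^{(0)}=0$) $$\mathscr D^{(0)}_{i+\frac12,j+\frac12} = \frac{\{ [u^{(0)}]_{i+\frac12} \}_{j+\frac12} }{2 \Delta x} + \frac{[ \{v^{(0)} \}_{i+\frac12} ]_{j+\frac12} }{2 \Delta y} = 0 \qquad \forall i,j$$ are solutions of the discrete limit equations of the scheme as $\epsilon\to0$.
   Context: Rescaled Euler equations: $\partial_t\rho+\nabla\cdot(\rho\mathbf v)=0$, $\partial_t(\rho\mathbf v)+\nabla\cdot(\rho\mathbf v\otimes\mathbf v+p/\epsilon^2\,\mathrm{Id})=0$, $\partial_t e+\nabla\cdot(\mathbf v(e+p))=0$, $e=\frac{p}{\gamma-1}+\frac12\epsilon^2\rho|\mathbf v|^2$, $\gamma>1$, $\mathbf v=(u,v)$, $\epsilon>0$ controlling the Mach number. Cells $(i,j)\in\mathbb Z^2$ of a Cartesian grid with spacings $\Delta x,\Delta y>0$, time step $\Delta t>0$. Cell quantities at time level $n$: $q=(\rho,\rho u,\rho v,e)$, with corresponding $u,v,p$. Notation for a grid function $q$ (in one index): $[q]_{i+\frac12}:=q_{i+1}-q_i$, $\{q\}_{i+\frac12}:=q_{i+1}+q_i$, $[q]_{i\pm1}:=q_{i+1}-q_{i-1}$, $\{\{q\}\}_{i\pm\frac12}:=q_{i+1}+2q_i+q_{i-1}$;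 for an edge quantity $X$, $[X]_{i\pm\frac12}:=X_{i+\frac12}-X_{i-\frac12}$ (and $[X]_{i\pm\frac12,j}$, $[X]_{i,j\pm\frac12}$ in two dimensions). In two dimensions the operators are composed, those with index $i$ acting in the first index, those with index $j$ in the second; e.g. $\{[q]_{i+\frac12}\}_{j+\frac12}=q_{i+1,j+1}-q_{i,j+1}+q_{i+1,j}-q_{ij}$. Scheme (S). With a relaxation parameter $a$ satisfying $a>\max(\rho c)$, $c$ being the speed of sound ($c=\sqrt{\gamma p/\rho}$), define the edge values (all data at time level $n$) $$u^*_{i+\frac12,j} = \frac{\{\{ \{ u \}_{i+\frac12} \}\}_{j\pm\frac12} }{8} - \frac1{2a\epsilon} \frac{\{\{ [p]_{i+\frac12} \}\}_{j\pm\frac12}}{4},$$ $$p^*_{i+\frac12,j} = \frac{\{\{\{p \}_{i+\frac12} \}\}_{j\pm\frac12} }{8} - \frac{a\epsilon}{2}\left( \frac{\{\{ [u]_{i+\frac12} \}\}_{j\pm\frac12}}{4} + \frac{\Delta x}{\Delta y} \frac{[\{v\}_{i+\frac12}]_{j\pm1} }{4}\right ),$$ $$v^*_{i,j+\frac12} = \frac{ \{ \{\{ v \}\}_{i\pm\frac12}\}_{j+\frac12} }{8} - \frac1{2a\epsilon} \frac{ [ \{\{ p \}\}_{i\pm\frac12}]_{j+\frac12}}{4},$$ $$p^*_{i,j+\frac12} = \frac{\{ \{\{p \}\}_{i\pm\frac12}\}_{j+\frac12} }{8} - \frac{a\epsilon}{2} \left( \frac{\Delta y}{\Delta x} \frac{\{[u]_{i\pm1}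 \}_{j+\frac12}}{4} + \frac{[ \{\{v\}\}_{i\pm\frac12}]_{j+\frac12} }{4}\right ).$$ Intermediate step: $L_{ij} := 1 + \frac{\Delta t}{\Delta x} [u^*]_{i\pm\frac12,j} + \frac{\Delta t}{\Delta y} [v^*]_{i,j\pm\frac12}$ and $$\rho^{n+1,-}_{ij} := \frac{\rho^n_{ij}}{L_{ij} },\quad (\rho u)^{n+1,-}_{ij} := \frac{(\rho u)^n_{ij} - \frac{\Delta t}{\Delta x} \frac{1}{\epsilon^2} [p^*]_{i\pm\frac12,j} }{L_{ij} },\quad (\rho v)^{n+1,-}_{ij} := \frac{(\rho v)^n_{ij} - \frac{\Delta t}{\Delta y} \frac{1}{\epsilon^2} [p^*]_{i,j\pm\frac12} }{L_{ij} },$$ $$e^{n+1,-}_{ij} := \frac{e^n_{ij} - \frac{\Delta t}{\Delta x} [u^* p^*]_{i\pm\frac12,j} - \frac{\Delta t}{\Delta y} [v^* p^*]_{i,j\pm\frac12}}{L_{ij} }.$$ Advective step (dimensionally split upwinding), for each component of $q$: $$q^{n+1}_{ij}=q^{n+1,-}_{ij}L_{ij}-\frac{\Delta t}{\Delta x}[f^{\mathrm{adv}}]_{i\pm\frac12,j}-\frac{\Delta t}{\Delta y}[g^{\mathrm{adv}}]_{i,j\pm\frac12},$$ with $f^{\mathrm{adv}}_{i+\frac12,j}=u^*_{i+\frac12,j}q^{n+1,-}_{ij}$ if $u^*_{i+\frac12,j}>0$ and $u^*_{i+\frac12,j}q^{n+1,-}_{i+1,j}$ otherwise; $g^{\mathrm{adv}}_{i,j+\frac12}=v^*_{i,j+\frac12}q^{n+1,-}_{ij}$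 if $v^*_{i,j+\frac12}>0$ and $v^*_{i,j+\frac12}q^{n+1,-}_{i,j+1}$ otherwise. Formal asymptotics: every cell quantity and $a$ is expanded as a formal power series $q_{ij}=q_{ij}^{(0)}+\epsilon q_{ij}^{(1)}+\epsilon^2q_{ij}^{(2)}+\dots$ (with $\rho^{(0)},a^{(0)}>0$; $\Delta t,\Delta x,\Delta y$ held fixed), is inserted into the scheme, and coefficients of equal powers of $\epsilon$ are collected; $X^{(k)}$ denotes the coefficient of $\epsilon^k$ of $X$. (In the upwind selection, the sign of a formal series is that of its lowest-order nonvanishing coefficient.) "const" means independent of the cell $(i,j)$ and of time. The discrete limit equations are: the equations at orders $\epsilon^{-2}$ and $\epsilon^{-1}$ in the update equations for both momentum components (i.e. the vanishing of the coefficients of $\epsilon^{-2}$ and $\epsilon^{-1}$ in the total flux differences, there being no time-difference contribution at these orders), and the order $\epsilon^0$ equation of the energy update with $e^{(0)}$ constant in time (i.e. the vanishing of the order $\epsilon^0$ coefficient of the total flux difference for $e$). *)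

theory Defs
  imports "HOL-Computational_Algebra.Computational_Algebra"
begin

text \<open>
  Formal power series in the Mach number parameter are elements of \<^typ>\<open>real fps\<close>. The scheme divides
  by powers of that parameter, so it is evaluated in the field \<^typ>\<open>real fls\<close> of formal Laurent
  series, the parameter itself being the indeterminate. The coefficient of its \<open>k\<close>-th power
  in \<open>X\<close> is \<open>fls_nth X k\<close>.
\<close>

abbreviation eps :: "real fls" where
  "eps \<equiv> fls_X"

text \<open>A formal series has the sign of its lowest-order nonvanishing coefficient
  (the zero series has \<open>fls_subdegree 0 = 0\<close> and hence is not positive).\<close>

definition fls_positive :: "real fls \<Rightarrow> bool" where
  "fls_positive X \<longleftrightarrow> fls_nth X (fls_subdegree X) > 0"


subsection \<open>Grid operators\<close>

text \<open>An edge quantity at \<open>i + 1/2\<close> is stored at index \<open>i\<close>. Thus \<open>diff_half\<close> and \<open>sum_half\<close>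
  map cell quantities to edge quantities, \<open>diff_two\<close> and \<open>sum_three\<close> map cell quantities to cell
  quantities, and \<open>edge_jump\<close> maps edge quantities to cell quantities.\<close>

definition diff_half :: "(int \<Rightarrow> 'a::comm_ring_1) \<Rightarrow> int \<Rightarrow> 'a" where
  "diff_half q i = q (i + 1) - q i"

definition sum_half :: "(int \<Rightarrow> 'a::comm_ring_1) \<Rightarrow> int \<Rightarrow> 'a" where
  "sum_half q i = q (i + 1) + q i"

definition diff_two :: "(int \<Rightarrow> 'a::comm_ring_1) \<Rightarrow> int \<Rightarrow> 'a" where
  "diff_two q i = q (i + 1) - q (i - 1)"

definition sum_three :: "(int \<Rightarrow> 'a::comm_ring_1) \<Rightarrow> int \<Rightarrow> 'a" where
  "sum_three q i = q (i + 1) + 2 * q i + q (i - 1)"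

definition edge_jump :: "(int \<Rightarrow> 'a::comm_ring_1) \<Rightarrow> int \<Rightarrow> 'a" where
  "edge_jump X i = X i - X (i - 1)"

definition in_i :: "((int \<Rightarrow> 'a) \<Rightarrow> int \<Rightarrow> 'a) \<Rightarrow> (int \<Rightarrow> int \<Rightarrow> 'a) \<Rightarrow> int \<Rightarrow> int \<Rightarrow> 'a" where
  "in_i F q i j = F (\<lambda>k. q k j) i"

definition in_j :: "((int \<Rightarrow> 'a) \<Rightarrow> int \<Rightarrow> 'a) \<Rightarrow> (int \<Rightarrow> int \<Rightarrow> 'a) \<Rightarrow> int \<Rightarrow> int \<Rightarrow> 'a" where
  "in_j F q i j = F (\<lambda>k. q i k) j"


subsection \<open>Parameters and cell data\<close>

record params =
  Gamma :: real
  Dt :: real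
  Dx :: real
  Dy :: real
  relax :: "real fps"

text \<open>As the leading coefficient of the density is positive, expanding the conserved
  quantities in power series is the same as expanding density, velocity and pressure.\<close>

record cells =
  dens :: "int \<Rightarrow> int \<Rightarrow> real fps"
  velx :: "int \<Rightarrow> int \<Rightarrow> real fps"
  vely :: "int \<Rightarrow> int \<Rightarrow> real fps"
  pres :: "int \<Rightarrow> int \<Rightarrow> real fps"

definition lift :: "(int \<Rightarrow> int \<Rightarrow> real fps) \<Rightarrow> int \<Rightarrow> int \<Rightarrow> real fls" where
  "lift q i j = fps_to_fls (q i j)"

text \<open>The speed of sound is the nonnegative square root of \<open>Gamma * p / rho\<close>.\<close>

definition is_sound_speed :: "params \<Rightarrow> cells \<Rightarrow> (int \<Rightarrow> int \<Rightarrow> real fps) \<Rightarrow> bool" where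
  "is_sound_speed S q c \<longleftrightarrow> (\<forall>i j.
     (lift c i j)\<^sup>2 = fls_const (Gamma S) * lift (pres q) i j / lift (dens q) i j \<and>
     (c i j = 0 \<or> fls_positive (lift c i j)))"

text \<open>The condition \<open>a > max (rho * c)\<close>, with the maximum over all cells spelled out pointwise, as it
  need not be attained on the infinite grid.\<close>

definition relax_dominates :: "params \<Rightarrow> cells \<Rightarrow> (int \<Rightarrow> int \<Rightarrow> real fps) \<Rightarrow> bool" where
  "relax_dominates S q c \<longleftrightarrow> (\<forall>i j.
     fls_positive (fps_to_fls (relax S) - lift (dens q) i j * lift c i j))"

datatype component = Mass | MomX | MomY | Energy

primrec conserved :: "params \<Rightarrow> cells \<Rightarrow> component \<Rightarrow> int \<Rightarrow> int \<Rightarrow> real fls" where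
  "conserved S q Mass = (\<lambda>i j. lift (dens q) i j)"
| "conserved S q MomX = (\<lambda>i j. lift (dens q) i j * lift (velx q) i j)"
| "conserved S q MomY = (\<lambda>i j. lift (dens q) i j * lift (vely q) i j)"
| "conserved S q Energy = (\<lambda>i j.
     lift (pres q) i j / fls_const (Gamma S - 1)
     + fls_const (1/2) * eps\<^sup>2 * lift (dens q) i j
         * ((lift (velx q) i j)\<^sup>2 + (lift (vely q) i j)\<^sup>2))"


subsection \<open>Edge values\<close>

text \<open>The suffix \<open>_x\<close> marks values at \<open>(i + 1/2, j)\<close>, the suffix \<open>_y\<close> values at \<open>(i, j + 1/2)\<close>.\<close>

definition ustar :: "params \<Rightarrow> cells \<Rightarrow> int \<Rightarrow> int \<Rightarrow> real fls" where
  "ustar S q i j =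
     in_j sum_three (in_i sum_half (lift (velx q))) i j / 8
     - 1 / (2 * fps_to_fls (relax S) * eps)
         * (in_j sum_three (in_i diff_half (lift (pres q))) i j / 4)"

definition pstar_x :: "params \<Rightarrow> cells \<Rightarrow> int \<Rightarrow> int \<Rightarrow> real fls" where
  "pstar_x S q i j =
     in_j sum_three (in_i sum_half (lift (pres q))) i j / 8
     - fps_to_fls (relax S) * eps / 2
         * (in_j sum_three (in_i diff_half (lift (velx q))) i j / 4
            + fls_const (Dx S / Dy S) * (in_j diff_two (in_i sum_half (lift (vely q))) i j / 4))"

definition vstar :: "params \<Rightarrow> cells \<Rightarrow> int \<Rightarrow> int \<Rightarrow> real fls" where
  "vstar S q i j =
     in_j sum_half (in_i sum_three (lift (vely q))) i j / 8
     - 1 / (2 * fps_to_fls (relax S) * eps)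
         * (in_j diff_half (in_i sum_three (lift (pres q))) i j / 4)"

definition pstar_y :: "params \<Rightarrow> cells \<Rightarrow> int \<Rightarrow> int \<Rightarrow> real fls" where
  "pstar_y S q i j =
     in_j sum_half (in_i sum_three (lift (pres q))) i j / 8
     - fps_to_fls (relax S) * eps / 2
         * (fls_const (Dy S / Dx S) * (in_j sum_half (in_i diff_two (lift (velx q))) i j / 4)
            + in_j diff_half (in_i sum_three (lift (vely q))) i j / 4)"


subsection \<open>Intermediate step\<close>

definition Lfac :: "params \<Rightarrow> cells \<Rightarrow> int \<Rightarrow> int \<Rightarrow> real fls" where
  "Lfac S q i j = 1 + fls_const (Dt S / Dx S) * in_i edge_jump (ustar S q) i j
                    + fls_const (Dt S / Dy S) * in_j edge_jump (vstar S q) i j"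

primrec lag_flux_diff :: "params \<Rightarrow> cells \<Rightarrow> component \<Rightarrow> int \<Rightarrow> int \<Rightarrow> real fls" where
  "lag_flux_diff S q Mass = (\<lambda>i j. 0)"
| "lag_flux_diff S q MomX = (\<lambda>i j.
     fls_const (1 / Dx S) * (1 / eps\<^sup>2) * in_i edge_jump (pstar_x S q) i j)"
| "lag_flux_diff S q MomY = (\<lambda>i j.
     fls_const (1 / Dy S) * (1 / eps\<^sup>2) * in_j edge_jump (pstar_y S q) i j)"
| "lag_flux_diff S q Energy = (\<lambda>i j.
     fls_const (1 / Dx S) * in_i edge_jump (\<lambda>k l. ustar S q k l * pstar_x S q k l) i j
     + fls_const (1 / Dy S) * in_j edge_jump (\<lambda>k l. vstar S q k l * pstar_y S q k l) i j)"

definition minus_state :: "params \<Rightarrow> cells \<Rightarrow> component \<Rightarrow> int \<Rightarrow> int \<Rightarrow> real fls" where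
  "minus_state S q k i j =
     (conserved S q k i j - fls_const (Dt S) * lag_flux_diff S q k i j) / Lfac S q i j"


subsection \<open>Advective step\<close>

definition upwind :: "real fls \<Rightarrow> real fls \<Rightarrow> real fls \<Rightarrow> real fls" where
  "upwind w l r = (if fls_positive w then w * l else w * r)"

definition fadv :: "params \<Rightarrow> cells \<Rightarrow> component \<Rightarrow> int \<Rightarrow> int \<Rightarrow> real fls" where
  "fadv S q k i j = upwind (ustar S q i j) (minus_state S q k i j) (minus_state S q k (i + 1) j)"

definition gadv :: "params \<Rightarrow> cells \<Rightarrow> component \<Rightarrow> int \<Rightarrow> int \<Rightarrow> real fls" where
  "gadv S q k i j = upwind (vstar S q i j) (minus_state S q k i j) (minus_state S q k i (j + 1))"

definition scheme_step :: "params \<Rightarrow> cells \<Rightarrow> component \<Rightarrow> int \<Rightarrow> int \<Rightarrow> real fls" where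
  "scheme_step S q k i j =
     minus_state S q k i j * Lfac S q i j
     - fls_const (Dt S / Dx S) * in_i edge_jump (fadv S q k) i j
     - fls_const (Dt S / Dy S) * in_j edge_jump (gadv S q k) i j"

definition total_flux_diff :: "params \<Rightarrow> cells \<Rightarrow> component \<Rightarrow> int \<Rightarrow> int \<Rightarrow> real fls" where
  "total_flux_diff S q k i j =
     lag_flux_diff S q k i j
     + fls_const (1 / Dx S) * in_i edge_jump (fadv S q k) i j
     + fls_const (1 / Dy S) * in_j edge_jump (gadv S q k) i j"

lemma scheme_step_eq_total_flux_diff:
  assumes "Lfac S q i j \<noteq> 0"
  shows "scheme_step S q k i j
           = conserved S q k i j - fls_const (Dt S) * total_flux_diff S q k i j"
proof -
  have c: "fls_const (Dt S / h) = fls_const (Dt S) * fls_const (1 / h)" for h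
    by (simp add: fls_const_mult_const)
  have "minus_state S q k i j * Lfac S q i j
          = conserved S q k i j - fls_const (Dt S) * lag_flux_diff S q k i j"
    unfolding minus_state_def using assms by (rule nonzero_eq_divide_eq [THEN iffD1, OF _ refl])
  then show ?thesis
    unfolding scheme_step_def total_flux_diff_def c by (simp only: distrib_left mult.assoc diff_diff_add)
qed


subsection \<open>Limit equations\<close>

text \<open>A sequence of cell data, indexed by the time level, solves the discrete limit equations.
  The conserved quantities are power series, so at the negative orders the momentum updates have no
  time difference; at order zero the energy update has none because the leading
  energy coefficient does not change in time.\<close>

definition solves_limit_equations :: "params \<Rightarrow> (nat \<Rightarrow> cells) \<Rightarrow> bool" where
  "solves_limit_equations S q \<longleftrightarrow> (\<forall>n i j.
     (\<forall>k\<in>{MomX, MomY}. fls_nth (total_flux_diff S (q n) k i j) (-2) = 0 \<and>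
                         fls_nth (total_flux_diff S (q n) k i j) (-1) = 0) \<and>
     fls_nth (conserved S (q (Suc n)) Energy i j) 0
       = fls_nth (conserved S (q n) Energy i j) 0 \<and>
     fls_nth (total_flux_diff S (q n) Energy i j) 0 = 0)"

text \<open>The value at the corner \<open>(i + 1/2, j + 1/2)\<close>, stored at \<open>(i, j)\<close>.\<close>

definition discrete_div :: "params \<Rightarrow> (int \<Rightarrow> int \<Rightarrow> real) \<Rightarrow> (int \<Rightarrow> int \<Rightarrow> real) \<Rightarrow> int \<Rightarrow> int \<Rightarrow> real" where
  "discrete_div S u v i j =
     in_j sum_half (in_i diff_half u) i j / (2 * Dx S)
     + in_j diff_half (in_i sum_half v) i j / (2 * Dy S)"

end

theory Submission
  imports Defs
begin

text \<open>
  Constancy of the two leading pressures makes the pressure contribution to the edge velocities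
  vanish at order \<open>0\<close>. What remains there are plain averages of the velocity, whose total jump over
  a cell is a multiple of the sum of the corner divergences around that cell, hence zero; so the
  Lagrangian factor has leading coefficient \<open>1\<close>. The order \<open>1\<close> viscous part of the edge pressures
  is likewise a combination of corner divergences, so the edge pressures are constant up to second
  order. This keeps the momentum fluxes regular, and at order \<open>0\<close> the energy flux advects
  the constants \<open>p\<close> and \<open>e\<close> with a discretely divergence-free velocity. As the constant \<open>e\<close> is the
  same on both sides of an edge, the upwind choice does not matter.
\<close>

section \<open>Laurent series without principal part\<close>

text \<open>The value is carried as an argument so that one syntactic pass over an expression both
  excludes negative powers and computes the constant term. On series without principal part this is
  the ring homomorphism setting the indeterminate to zero.\<close>

definition regular_value :: "'a::field fls \<Rightarrow> 'a \<Rightarrow> bool" where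
  "regular_value X x \<longleftrightarrow> (\<exists>f. X = fps_to_fls f \<and> fps_nth f 0 = x)"

lemma regular_value_fps: "regular_value (fps_to_fls f) (fps_nth f 0)"
  by (auto simp: regular_value_def)

lemma regular_value_lift: "regular_value (lift q i j) (fps_nth (q i j) 0)"
  unfolding lift_def by (rule regular_value_fps)

lemma regular_value_const: "regular_value (fls_const x) x"
  using regular_value_fps[of "fps_const x"] by simp

lemma regular_value_1: "regular_value 1 1"
  using regular_value_fps[of 1] by simp

lemma regular_value_numeral: "regular_value (numeral n) (numeral n)"
  using regular_value_const[of "numeral n"] by simp

lemma regular_value_X: "regular_value fls_X 0"
  using regular_value_fps[of fps_X] by simp

lemma regular_value_add: "regular_value X x \<Longrightarrow> regular_value Y y \<Longrightarrow> regular_value (X + Y) (x + y)"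
  unfolding regular_value_def by (metis fps_add_nth fps_to_fls_plus)

lemma regular_value_diff: "regular_value X x \<Longrightarrow> regular_value Y y \<Longrightarrow> regular_value (X - Y) (x - y)"
  unfolding regular_value_def by (metis fps_sub_nth fps_to_fls_minus)

lemma regular_value_mult: "regular_value X x \<Longrightarrow> regular_value Y y \<Longrightarrow> regular_value (X * Y) (x * y)"
  unfolding regular_value_def by (metis fps_mult_nth_0 fls_times_fps_to_fls)

lemma regular_value_power: "regular_value X x \<Longrightarrow> regular_value (X ^ n) (x ^ n)"
  by (induction n) (auto intro: regular_value_1 regular_value_mult)

text \<open>A power series with nonzero constant term is a unit among the power series, so no
  principal part arises.\<close>

lemma regular_value_divide:
  assumes "regular_value X x" "regular_value Y y" "y \<noteq> 0"
  shows "regular_value (X / Y) (x / y)"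
proof -
  obtain g where g: "Y = fps_to_fls g" "fps_nth g 0 = y"
    using assms by (auto simp: regular_value_def)
  have "fps_to_fls (inverse g) * Y = 1"
    using g assms(3) by (simp add: inverse_mult_eq_1 flip: fls_times_fps_to_fls)
  then have "inverse Y = fps_to_fls (inverse g)"
    by (metis inverse_unique mult.commute)
  then have "regular_value (inverse Y) (inverse y)"
    using g regular_value_fps[of "inverse g"] by simp
  then show ?thesis
    using regular_value_mult[OF assms(1)] by (simp add: divide_inverse)
qed

lemmas regular_value_intros = regular_value_lift regular_value_const regular_value_1
  regular_value_numeral regular_value_X regular_value_add regular_value_diff regular_value_mult regular_value_power

lemma regular_value_eq: "regular_value X x \<Longrightarrow> x = y \<Longrightarrow> regular_value X y"
  by simp

lemma regular_value_nth_0: "regular_value X x \<Longrightarrow> fls_nth X 0 = x"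
  by (auto simp: regular_value_def)

lemma regular_value_nth_neg: "regular_value X x \<Longrightarrow> k < 0 \<Longrightarrow> fls_nth X k = 0"
  by (auto simp: regular_value_def)

text \<open>Supplies the extra power of \<open>eps\<close> in the viscous part of the edge pressures
  once its bracket vanishes at order 0.\<close>

lemma regular_value_0_factor:
  assumes "regular_value X 0"
  obtains Y y where "X = fls_X * Y" "regular_value Y y"
proof -
  obtain f where f: "X = fps_to_fls f" "fps_nth f 0 = 0"
    using assms by (auto simp: regular_value_def)
  have "f = fps_X * fps_shift 1 f"
    using f(2) by (intro fps_ext) auto
  then have "X = fls_X * fps_to_fls (fps_shift 1 f)"
    using f(1) by (metis fls_times_fps_to_fls fps_X_to_fls)
  then show ?thesis using that regular_value_fps by blast
qed

text \<open>Applied to the pressure, this isolates the two coefficients that are constant over the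
  grid.\<close>

lemma fps_second_order_expansion:
  "fps_to_fls f = fls_const (fps_nth f 0) + fls_const (fps_nth f 1) * fls_X
     + fls_X\<^sup>2 * fps_to_fls (fps_shift 2 f)"
proof -
  have "f = fps_const (fps_nth f 0) + fps_const (fps_nth f 1) * fps_X + fps_X\<^sup>2 * fps_shift 2 f"
  proof (rule fps_ext)
    fix n :: nat
    consider "n = 0" | "n = 1" | "n \<ge> 2" by linarith
    then show "fps_nth f n = fps_nth (fps_const (fps_nth f 0) + fps_const (fps_nth f 1) * fps_X
      + fps_X\<^sup>2 * fps_shift 2 f) n"
      by cases (auto simp: fps_X_power_mult_nth simp flip: Suc_diff_le add_2_eq_Suc')
  qed
  then show ?thesis
    by (metis fps_to_fls_plus fls_times_fps_to_fls fps_X_to_fls fps_to_fls_power fps_const_to_fls)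
qed

text \<open>\<open>A\<close> stands for the part common to both edges, which cancels; the square in
  front of the remainders absorbs the division by the squared Mach parameter.\<close>

lemma second_order_jump:
  fixes x :: "'a::field"
  assumes "x \<noteq> 0"
  shows "c * (1 / x\<^sup>2) * (A + x\<^sup>2 * r - (A + x\<^sup>2 * s)) = c * (r - s)"
  using assms by (simp add: field_simps)

text \<open>With a common leading value \<open>x\<close> on both sides, the two branches agree at
  order 0 whatever the sign of \<open>w\<close>.\<close>

lemma regular_value_upwind:
  assumes "regular_value w w0" "regular_value l x" "regular_value r x"
  shows "regular_value (upwind w l r) (w0 * x)"
  using assms by (auto simp: upwind_def intro: regular_value_mult)

text \<open>Without a common value the leading coefficient depends on the branch, but regularity
  survives.\<close>

lemma regular_upwind:
  assumes "regular_value w w0" "\<exists>x. regular_value l x" "\<exists>x. regular_value r x"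
  shows "\<exists>x. regular_value (upwind w l r) x"
  using assms by (auto simp: upwind_def intro: regular_value_mult)


section \<open>Data with constant leading pressures and divergence-free leading velocity\<close>

lemmas grid_ops = in_i_def in_j_def diff_half_def sum_half_def diff_two_def sum_three_def
  edge_jump_def

locale incompressible_data =
  fixes S :: params and q :: cells and P0 P1 :: real
  assumes gamma: "Gamma S > 1" and dx: "Dx S > 0" and dy: "Dy S > 0"
    and relax: "fps_nth (relax S) 0 > 0"
    and p0: "fps_nth (pres q i j) 0 = P0"
    and p1: "fps_nth (pres q i j) 1 = P1"
    and div0: "discrete_div S (\<lambda>k l. fps_nth (velx q k l) 0) (\<lambda>k l. fps_nth (vely q k l) 0) i j = 0"
begin

abbreviation "u0 \<equiv> \<lambda>i j. fps_nth (velx q i j) 0"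
abbreviation "v0 \<equiv> \<lambda>i j. fps_nth (vely q i j) 0"
abbreviation "us0 \<equiv> \<lambda>i j. in_j sum_three (in_i sum_half u0) i j / 8"
abbreviation "vs0 \<equiv> \<lambda>i j. in_j sum_half (in_i sum_three v0) i j / 8"
abbreviation "prem \<equiv> \<lambda>i j. fps_shift 2 (pres q i j)"

lemma lift_pres: "lift (pres q) i j = fls_const P0 + fls_const P1 * eps + eps\<^sup>2 * lift prem i j"
  unfolding lift_def using fps_second_order_expansion[of "pres q i j"] p0 p1 by simp

lemma corner_div:
  "Dy S * in_j sum_half (in_i diff_half u0) i j + Dx S * in_j diff_half (in_i sum_half v0) i j = 0"
  using div0[of i j] dx dy by (simp add: discrete_div_def field_simps)

lemma edge_velocity_div:
  "in_i edge_jump us0 i j / Dx S + in_j edge_jump vs0 i j / Dy S = 0"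
proof -
  \<comment> \<open>With denominators cleared, this is the sum of the four corner equations around
    the cell: 1-2-1 weights and double-step differences both arise by adding neighbouring
    corners.\<close>
  have "Dy S * (8 * in_i edge_jump us0 i j) + Dx S * (8 * in_j edge_jump vs0 i j) = 0"
    using corner_div[of i j] corner_div[of "i - 1" j] corner_div[of i "j - 1"]
      corner_div[of "i - 1" "j - 1"]
    by (simp add: grid_ops algebra_simps add_divide_distrib diff_divide_distrib)
  then show ?thesis using dx dy by (simp add: field_simps)
qed

section \<open>Edge velocities and edge pressures\<close>

lemma relax_nz: "fps_to_fls (relax S) \<noteq> 0"
  using relax by auto

lemma regular_ustar: "regular_value (ustar S q i j) (us0 i j)"
proof -
  \<comment> \<open>Differencing kills \<open>P0\<close> and \<open>P1\<close>, so the pressure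
    difference starts at order 2 and dividing by \<open>eps\<close> still leaves one power of
    \<open>eps\<close>.\<close>
  have eq: "ustar S q i j = in_j sum_three (in_i sum_half (lift (velx q))) i j / 8
     - eps * (in_j sum_three (in_i diff_half (lift prem)) i j / (8 * fps_to_fls (relax S)))"
    unfolding ustar_def lift_pres grid_ops using relax_nz
    by (simp add: field_simps power2_eq_square)
  show ?thesis
    unfolding eq grid_ops
    \<comment> \<open>The value is left schematic and built by the rules; \<open>simp\<close>
      settles the nonzero denominators and the final comparison.\<close>
    by (rule regular_value_eq)
      (rule regular_value_intros regular_value_divide regular_value_fps | use relax in simp)+
qed

lemma regular_vstar: "regular_value (vstar S q i j) (vs0 i j)"
proof -
  have eq: "vstar S q i j = in_j sum_half (in_i sum_three (lift (vely q))) i j / 8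
     - eps * (in_j diff_half (in_i sum_three (lift prem)) i j / (8 * fps_to_fls (relax S)))"
    unfolding vstar_def lift_pres grid_ops using relax_nz
    by (simp add: field_simps power2_eq_square)
  show ?thesis
    unfolding eq grid_ops
    by (rule regular_value_eq)
      (rule regular_value_intros regular_value_divide regular_value_fps | use relax in simp)+
qed

lemma pstar_x_expansion:
  obtains R r where "pstar_x S q i j = fls_const P0 + fls_const P1 * eps + eps\<^sup>2 * R" "regular_value R r"
proof -
  define V where "V = in_j sum_three (in_i diff_half (lift (velx q))) i j / 4
    + fls_const (Dx S / Dy S) * (in_j diff_two (in_i sum_half (lift (vely q))) i j / 4)"
  have pstar: "pstar_x S q i j = in_j sum_three (in_i sum_half (lift (pres q))) i j / 8 - fps_to_fls (relax S) * eps / 2 * V"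
    by (simp add: pstar_x_def V_def)
  have "in_j sum_three (in_i diff_half u0) i j / 4
    + Dx S / Dy S * (in_j diff_two (in_i sum_half v0) i j / 4) = 0"
  proof -
    \<comment> \<open>The viscous bracket combines the two corners at the ends of the edge,
      \<open>(i, j)\<close> and \<open>(i, j - 1)\<close>.\<close>
    have "Dy S * in_j sum_three (in_i diff_half u0) i j
        + Dx S * in_j diff_two (in_i sum_half v0) i j = 0"
      using corner_div[of i j] corner_div[of i "j - 1"] by (simp add: grid_ops algebra_simps)
    then show ?thesis using dy by (simp add: field_simps)
  qed
  moreover have "regular_value V (in_j sum_three (in_i diff_half u0) i j / 4
    + Dx S / Dy S * (in_j diff_two (in_i sum_half v0) i j / 4))"
    unfolding V_def grid_ops by (intro regular_value_intros regular_value_divide) simp_all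
  ultimately obtain W w where W: "V = eps * W" "regular_value W w"
    using regular_value_0_factor by metis
  \<comment> \<open>The averaging weights sum to 8, so \<open>P0\<close> and \<open>P1\<close> pass
    through unchanged. The viscous prefactor and \<open>V\<close> contribute one \<open>eps\<close>
    each, so both remaining parts have order at least 2.\<close>
  define R where "R = in_j sum_three (in_i sum_half (lift prem)) i j / 8
    - fps_to_fls (relax S) * W / 2"
  have "pstar_x S q i j = fls_const P0 + fls_const P1 * eps + eps\<^sup>2 * R"
    unfolding pstar W(1) R_def lift_pres grid_ops
    by (simp add: field_simps power2_eq_square)
  moreover have "\<exists>r. regular_value R r"
    unfolding R_def grid_ops
    by (rule exI, (rule regular_value_intros regular_value_divide regular_value_fps W(2) | simp)+)
  ultimately show ?thesis using that by blast
qed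

lemma pstar_y_expansion:
  obtains R r where "pstar_y S q i j = fls_const P0 + fls_const P1 * eps + eps\<^sup>2 * R" "regular_value R r"
proof -
  define V where "V = fls_const (Dy S / Dx S) * (in_j sum_half (in_i diff_two (lift (velx q))) i j / 4)
    + in_j diff_half (in_i sum_three (lift (vely q))) i j / 4"
  have pstar: "pstar_y S q i j = in_j sum_half (in_i sum_three (lift (pres q))) i j / 8 - fps_to_fls (relax S) * eps / 2 * V"
    by (simp add: pstar_y_def V_def)
  have "Dy S / Dx S * (in_j sum_half (in_i diff_two u0) i j / 4)
    + in_j diff_half (in_i sum_three v0) i j / 4 = 0"
  proof -
    \<comment> \<open>Here the edge is horizontal and its end corners are \<open>(i, j)\<close> and
      \<open>(i - 1, j)\<close>.\<close>
    have "Dy S * in_j sum_half (in_i diff_two u0) i j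
        + Dx S * in_j diff_half (in_i sum_three v0) i j = 0"
      using corner_div[of i j] corner_div[of "i - 1" j] by (simp add: grid_ops algebra_simps)
    then show ?thesis using dx by (simp add: field_simps)
  qed
  moreover have "regular_value V (Dy S / Dx S * (in_j sum_half (in_i diff_two u0) i j / 4)
    + in_j diff_half (in_i sum_three v0) i j / 4)"
    unfolding V_def grid_ops by (intro regular_value_intros regular_value_divide) simp_all
  ultimately obtain W w where W: "V = eps * W" "regular_value W w"
    using regular_value_0_factor by metis
  define R where "R = in_j sum_half (in_i sum_three (lift prem)) i j / 8
    - fps_to_fls (relax S) * W / 2"
  have "pstar_y S q i j = fls_const P0 + fls_const P1 * eps + eps\<^sup>2 * R"
    unfolding pstar W(1) R_def lift_pres grid_ops
    by (simp add: field_simps power2_eq_square)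
  moreover have "\<exists>r. regular_value R r"
    unfolding R_def grid_ops
    by (rule exI, (rule regular_value_intros regular_value_divide regular_value_fps W(2) | simp)+)
  ultimately show ?thesis using that by blast
qed

lemma regular_pstar_x: "regular_value (pstar_x S q i j) P0"
proof -
  obtain R r where R: "pstar_x S q i j = fls_const P0 + fls_const P1 * eps + eps\<^sup>2 * R"
    "regular_value R r" by (rule pstar_x_expansion)
  have "regular_value (fls_const P0 + fls_const P1 * eps + eps\<^sup>2 * R) (P0 + P1 * 0 + 0\<^sup>2 * r)"
    by (intro regular_value_intros R(2))
  then show ?thesis by (simp add: R(1))
qed

lemma regular_pstar_y: "regular_value (pstar_y S q i j) P0"
proof -
  obtain R r where R: "pstar_y S q i j = fls_const P0 + fls_const P1 * eps + eps\<^sup>2 * R"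
    "regular_value R r" by (rule pstar_y_expansion)
  have "regular_value (fls_const P0 + fls_const P1 * eps + eps\<^sup>2 * R) (P0 + P1 * 0 + 0\<^sup>2 * r)"
    by (intro regular_value_intros R(2))
  then show ?thesis by (simp add: R(1))
qed

section \<open>Lagrangian factor and Lagrangian fluxes\<close>

lemma regular_Lfac: "regular_value (Lfac S q i j) 1"
proof -
  have "regular_value (Lfac S q i j)
    (1 + Dt S / Dx S * (us0 i j - us0 (i - 1) j) + Dt S / Dy S * (vs0 i j - vs0 i (j - 1)))"
    unfolding Lfac_def in_i_def in_j_def edge_jump_def
    by (intro regular_value_intros regular_ustar[unfolded in_i_def in_j_def]
        regular_vstar[unfolded in_i_def in_j_def])
  moreover have "Dt S / Dx S * (us0 i j - us0 (i - 1) j) + Dt S / Dy S * (vs0 i j - vs0 i (j - 1))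
    = Dt S * (in_i edge_jump us0 i j / Dx S + in_j edge_jump vs0 i j / Dy S)"
    by (simp add: in_i_def in_j_def edge_jump_def field_simps)
  ultimately show ?thesis by (simp add: edge_velocity_div add.assoc)
qed

text \<open>The two edges share their terms of orders 0 and 1, so only \<open>R - R'\<close>
  survives the division by \<open>eps^2\<close>.\<close>

lemma regular_lag_MomX: "\<exists>x. regular_value (lag_flux_diff S q MomX i j) x"
proof -
  obtain R r where R: "pstar_x S q i j = fls_const P0 + fls_const P1 * eps + eps\<^sup>2 * R"
    "regular_value R r" by (rule pstar_x_expansion)
  obtain R' r' where R': "pstar_x S q (i - 1) j = fls_const P0 + fls_const P1 * eps + eps\<^sup>2 * R'"
    "regular_value R' r'" by (rule pstar_x_expansion)
  have "lag_flux_diff S q MomX i j = fls_const (1 / Dx S) * (R - R')"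
    unfolding lag_flux_diff.simps in_i_def edge_jump_def R(1) R'(1)
    by (rule second_order_jump) simp
  then show ?thesis using R(2) R'(2) by (metis regular_value_const regular_value_diff regular_value_mult)
qed

lemma regular_lag_MomY: "\<exists>x. regular_value (lag_flux_diff S q MomY i j) x"
proof -
  obtain R r where R: "pstar_y S q i j = fls_const P0 + fls_const P1 * eps + eps\<^sup>2 * R"
    "regular_value R r" by (rule pstar_y_expansion)
  obtain R' r' where R': "pstar_y S q i (j - 1) = fls_const P0 + fls_const P1 * eps + eps\<^sup>2 * R'"
    "regular_value R' r'" by (rule pstar_y_expansion)
  have "lag_flux_diff S q MomY i j = fls_const (1 / Dy S) * (R - R')"
    unfolding lag_flux_diff.simps in_j_def edge_jump_def R(1) R'(1)
    by (rule second_order_jump) simp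
  then show ?thesis using R(2) R'(2) by (metis regular_value_const regular_value_diff regular_value_mult)
qed

text \<open>All edge pressures have leading value \<open>P0\<close>, which factors out and leaves
  the divergence of the edge velocities.\<close>

lemma regular_lag_Energy: "regular_value (lag_flux_diff S q Energy i j) 0"
proof -
  have "regular_value (lag_flux_diff S q Energy i j)
    (1 / Dx S * (us0 i j * P0 - us0 (i - 1) j * P0) + 1 / Dy S * (vs0 i j * P0 - vs0 i (j - 1) * P0))"
    unfolding lag_flux_diff.simps in_i_def[of edge_jump] in_j_def[of edge_jump] edge_jump_def
    by (intro regular_value_intros regular_ustar regular_vstar regular_pstar_x regular_pstar_y)
  moreover have "1 / Dx S * (us0 i j * P0 - us0 (i - 1) j * P0)
      + 1 / Dy S * (vs0 i j * P0 - vs0 i (j - 1) * P0)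
    = P0 * (in_i edge_jump us0 i j / Dx S + in_j edge_jump vs0 i j / Dy S)"
    by (simp add: in_i_def in_j_def edge_jump_def field_simps)
  ultimately show ?thesis by (simp add: edge_velocity_div)
qed

text \<open>The kinetic part carries \<open>eps^2\<close>, so only the pressure reaches order
  0.\<close>

lemma regular_conserved_Energy: "regular_value (conserved S q Energy i j) (P0 / (Gamma S - 1))"
  unfolding conserved.simps
  by (rule regular_value_eq)
    (rule regular_value_intros regular_value_divide | use gamma p0 in simp)+

section \<open>Intermediate state, upwind fluxes and total flux differences\<close>

lemma regular_minus_state:
  assumes "regular_value (conserved S q k i j) x" "regular_value (lag_flux_diff S q k i j) y"
  shows "regular_value (minus_state S q k i j) (x - Dt S * y)"
  using regular_value_divide[OF regular_value_diff[OF assms(1) regular_value_mult[OF regular_value_const assms(2)]]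
      regular_Lfac]
  by (simp add: minus_state_def)

lemma regular_minus_state_Energy: "regular_value (minus_state S q Energy i j) (P0 / (Gamma S - 1))"
  using regular_minus_state[OF regular_conserved_Energy regular_lag_Energy] by simp

text \<open>The limit equations test momentum only at negative orders, so the leading values may
  stay unspecified and vary from cell to cell.\<close>

lemma regular_minus_state_Mom:
  assumes "k \<in> {MomX, MomY}"
  shows "\<exists>x. regular_value (minus_state S q k i j) x"
proof -
  have "\<exists>x. regular_value (conserved S q k i j) x"
    using assms regular_value_mult[OF regular_value_lift regular_value_lift] by fastforce
  then show ?thesis
    using assms regular_lag_MomX regular_lag_MomY regular_minus_state by fast
qed

lemma regular_total_flux_diff_Mom:
  assumes k: "k \<in> {MomX, MomY}"
  shows "\<exists>x. regular_value (total_flux_diff S q k i j) x"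
proof -
  have f: "\<exists>x. regular_value (fadv S q k i j) x" for i j
    unfolding fadv_def
    by (rule regular_upwind[OF regular_ustar regular_minus_state_Mom[OF k] regular_minus_state_Mom[OF k]])
  have g: "\<exists>x. regular_value (gadv S q k i j) x" for i j
    unfolding gadv_def
    by (rule regular_upwind[OF regular_vstar regular_minus_state_Mom[OF k] regular_minus_state_Mom[OF k]])
  have l: "\<exists>x. regular_value (lag_flux_diff S q k i j) x"
    using k regular_lag_MomX regular_lag_MomY by blast
  show ?thesis
    unfolding total_flux_diff_def in_i_def in_j_def edge_jump_def
    using f[of i j] f[of "i - 1" j] g[of i j] g[of i "j - 1"] l
    by (meson regular_value_const regular_value_add regular_value_diff regular_value_mult)
qed

lemma regular_total_flux_diff_Energy: "regular_value (total_flux_diff S q Energy i j) 0"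
proof -
  define E where "E = P0 / (Gamma S - 1)"
  have f: "regular_value (fadv S q Energy i j) (us0 i j * E)" for i j
    unfolding fadv_def E_def
    by (intro regular_value_upwind regular_ustar regular_minus_state_Energy)
  have g: "regular_value (gadv S q Energy i j) (vs0 i j * E)" for i j
    unfolding gadv_def E_def
    by (intro regular_value_upwind regular_vstar regular_minus_state_Energy)
  have "regular_value (total_flux_diff S q Energy i j)
    (0 + 1 / Dx S * (us0 i j * E - us0 (i - 1) j * E) + 1 / Dy S * (vs0 i j * E - vs0 i (j - 1) * E))"
    unfolding total_flux_diff_def in_i_def[of edge_jump] in_j_def[of edge_jump] edge_jump_def
    by (intro regular_value_add regular_value_diff regular_value_mult regular_value_const f g regular_lag_Energy)
  \<comment> \<open>The constant \<open>E\<close> factors out, again leaving the divergence of the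
    edge velocities.\<close>
  moreover have "0 + 1 / Dx S * (us0 i j * E - us0 (i - 1) j * E)
      + 1 / Dy S * (vs0 i j * E - vs0 i (j - 1) * E)
    = E * (in_i edge_jump us0 i j / Dx S + in_j edge_jump vs0 i j / Dy S)"
    by (simp add: in_i_def in_j_def edge_jump_def field_simps)
  ultimately show ?thesis by (simp add: edge_velocity_div)
qed

end

theorem theorem3p1:
  fixes S :: params and q :: "nat \<Rightarrow> cells" and c :: "nat \<Rightarrow> int \<Rightarrow> int \<Rightarrow> real fps"
  assumes "Gamma S > 1" and "Dt S > 0" and "Dx S > 0" and "Dy S > 0"
    and "fps_nth (relax S) 0 > 0"
    and "\<And>n i j. fps_nth (dens (q n) i j) 0 > 0"
    and "\<And>n. is_sound_speed S (q n) (c n)"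
    and "\<And>n. relax_dominates S (q n) (c n)"
    and "\<exists>P. \<forall>n i j. fps_nth (pres (q n) i j) 0 = P"
    and "\<exists>P. \<forall>n i j. fps_nth (pres (q n) i j) 1 = P"
    and "\<And>n i j. discrete_div S (\<lambda>k l. fps_nth (velx (q n) k l) 0)
                              (\<lambda>k l. fps_nth (vely (q n) k l) 0) i j = 0"
  shows "solves_limit_equations S q"
proof -
  obtain P0 P1 where "\<forall>n i j. fps_nth (pres (q n) i j) 0 = P0"
    and "\<forall>n i j. fps_nth (pres (q n) i j) 1 = P1"
    using assms(9,10) by blast
  \<comment> \<open>\<open>P0\<close> and \<open>P1\<close> are chosen before \<open>n\<close>, so
    the same constants serve every time level.\<close>
  then have D: "incompressible_data S (q n) P0 P1" for n
    using assms(1,3,4,5,11) by unfold_locales auto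
  have "fls_nth (total_flux_diff S (q n) k i j) m = 0" if "k \<in> {MomX, MomY}" "m < 0" for n k i j m
    using incompressible_data.regular_total_flux_diff_Mom[OF D that(1)] that(2)
      regular_value_nth_neg by blast
  \<comment> \<open>The right-hand side does not mention \<open>n\<close>, which gives the equality
    of leading energies at successive time levels.\<close>
  moreover have "fls_nth (conserved S (q n) Energy i j) 0 = P0 / (Gamma S - 1)" for n i j
    by (rule regular_value_nth_0 incompressible_data.regular_conserved_Energy D)+
  moreover have "fls_nth (total_flux_diff S (q n) Energy i j) 0 = 0" for n i j
    by (rule regular_value_nth_0 incompressible_data.regular_total_flux_diff_Energy D)+
  ultimately show ?thesis
    unfolding solves_limit_equations_def by simp
qed

end
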